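(* Let $M$ be a preGarside monoid with set of atoms $\mathcal{A}(M)$, let $f_L$ be a left selector on $\mathcal{A}(M)$ in $M$, and let $f_R$ be a right selector on $\mathcal{A}(M)$ in $M$. Let $X$ be a subset of $\mathcal{A}(M)$, and let $N$ be the submonoid of $M$ generated by $X$. Then $N$ is a parabolic submonoid of $M$ if and only if the following properties hold. (a) For all $x,y \in X$ with $x \neq y$, if $x \vee_L y$ exists, then $f_L(x,y), f_L(y,x) \in X^*$. Similarly, for all $x,y \in X$ with $x \neq y$, if $x \vee_R y$ exists, then $f_R(x,y), f_R(y,x) \in X^*$. (b) For all $x \in X$ and $y \in \mathcal{A}(M) \setminus X$, if $x \vee_L y$ exists, then $f_L(x,y) \notin X^*$. Similarly, for all $x \in X$ and $y \in \mathcal{A}(M) \setminus X$, if $x \vee_R y$ exists, then $f_R(y,x) \notin X^*$.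
   Context: For a monoid $M$: $b\preceq_L a$ means $a=bc$ for some $c\in M$; $c\preceq_R a$ means $a=bc$ for some $b\in M$. $M$ is cancellative if $cad=cbd$ implies $a=b$. $M$ is atomic if there is a map $\nu:M\to\mathbb{N}$ with $\nu(a)>0$ for $a\ne 1$ and $\nu(ab)\ge\nu(a)+\nu(b)$. An atom of an atomic monoid is an element $a\ne 1$ such that $a=bc$ implies $b=1$ or $c=1$; the set $\mathcal{A}(M)$ of atoms generates $M$. A preGarside monoid is a cancellative atomic monoid $M$ such that, for all $a,b\in M$, if $a,b$ have a common upper bound for $\preceq_L$ then they have a least one, $a\vee_L b$, and if they have a common upper bound for $\preceq_R$ then they have a least one, $a\vee_R b$. A submonoid $N$ of $M$ is a (standard) parabolic submonoid if (i) $ab\in N$ implies $a,b\in N$ for all $a,b\in M$; and (ii) for all $a,b\in N$, $a\vee_L b\in N$ whenever it exists in $M$, and $a\vee_R b\in N$ whenever it exists in $M$. Let $S$ be a generating set of $M$ with $1\notin S$; $S^*$ is the free monoid on $S$. A left selector on $S$ in $M$ is a map $f_L$ assigning to each ordered pair $(x,y)\in S\times S$ with $x\ne y$ and $x\vee_L y$ existing a word $f_L(x,y)\in S^*$ such that $x\,f_L(x,y)$ and $y\,f_L(y,x)$ both represent $x\vee_L y$. A right selector on $S$ in $M$ is a map $f_R$ assigning to each ordered pair $(x,y)\in S\times S$ with $x\neq y$ and $x\vee_R y$ existing a word $f_R(x,y)\in S^*$ such that $f_R(y,x)\,x$ and $f_R(x,y)\,y$ both represent $x\vee_R y$. $X^*\subseteq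 S^*$ is the set of words with all letters in $X$. *)

theory Defs
  imports "HOL-Algebra.Divisibility"
begin

text \<open>
  Left divisibility is the library relation \<open>b divides\<^bsub>M\<^esub> a\<close>, i.e.
  \<open>a = b \<otimes>\<^bsub>M\<^esub> c\<close> for some \<open>c \<in> carrier M\<close>.
\<close>

definition right_divides :: "('a, 'm) monoid_scheme \<Rightarrow> 'a \<Rightarrow> 'a \<Rightarrow> bool" where
  "right_divides M c a \<longleftrightarrow> (\<exists>b\<in>carrier M. a = b \<otimes>\<^bsub>M\<^esub> c)"

text \<open>
  The joins are given as relations; the result is unique in a preGarside monoid
  (lemmas \<open>left_join_unique\<close> and \<open>right_join_unique\<close>).
\<close>

definition is_left_join :: "('a, 'm) monoid_scheme \<Rightarrow> 'a \<Rightarrow> 'a \<Rightarrow> 'a \<Rightarrow> bool" where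
  "is_left_join M a b m \<longleftrightarrow>
     m \<in> carrier M \<and> a divides\<^bsub>M\<^esub> m \<and> b divides\<^bsub>M\<^esub> m \<and>
     (\<forall>n\<in>carrier M. a divides\<^bsub>M\<^esub> n \<and> b divides\<^bsub>M\<^esub> n \<longrightarrow> m divides\<^bsub>M\<^esub> n)"

definition is_right_join :: "('a, 'm) monoid_scheme \<Rightarrow> 'a \<Rightarrow> 'a \<Rightarrow> 'a \<Rightarrow> bool" where
  "is_right_join M a b m \<longleftrightarrow>
     m \<in> carrier M \<and> right_divides M a m \<and> right_divides M b m \<and>
     (\<forall>n\<in>carrier M. right_divides M a n \<and> right_divides M b n \<longrightarrow> right_divides M m n)"

definition left_join_exists :: "('a, 'm) monoid_scheme \<Rightarrow> 'a \<Rightarrow> 'a \<Rightarrow> bool" where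
  "left_join_exists M a b \<longleftrightarrow> (\<exists>m. is_left_join M a b m)"

definition right_join_exists :: "('a, 'm) monoid_scheme \<Rightarrow> 'a \<Rightarrow> 'a \<Rightarrow> bool" where
  "right_join_exists M a b \<longleftrightarrow> (\<exists>m. is_right_join M a b m)"

locale preGarside = monoid M for M :: "('a, 'm) monoid_scheme" (structure) +
  assumes cancellative:
      "\<lbrakk>a \<in> carrier M; b \<in> carrier M; c \<in> carrier M; d \<in> carrier M;
        c \<otimes> a \<otimes> d = c \<otimes> b \<otimes> d\<rbrakk> \<Longrightarrow> a = b"
    and atomic:
      "\<exists>\<nu> :: 'a \<Rightarrow> nat.
         (\<forall>a\<in>carrier M. a \<noteq> \<one> \<longrightarrow> \<nu> a > 0) \<and>
         (\<forall>a\<in>carrier M. \<forall>b\<in>carrier M. \<nu> (a \<otimes> b) \<ge> \<nu> a + \<nu> b)"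
    and left_join_if_bounded:
      "\<lbrakk>a \<in> carrier M; b \<in> carrier M; \<exists>n\<in>carrier M. a divides n \<and> b divides n\<rbrakk>
        \<Longrightarrow> left_join_exists M a b"
    and right_join_if_bounded:
      "\<lbrakk>a \<in> carrier M; b \<in> carrier M; \<exists>n\<in>carrier M. right_divides M a n \<and> right_divides M b n\<rbrakk>
        \<Longrightarrow> right_join_exists M a b"

definition atoms :: "('a, 'm) monoid_scheme \<Rightarrow> 'a set" where
  "atoms M = {a \<in> carrier M. a \<noteq> \<one>\<^bsub>M\<^esub> \<and>
     (\<forall>b\<in>carrier M. \<forall>c\<in>carrier M. a = b \<otimes>\<^bsub>M\<^esub> c \<longrightarrow> b = \<one>\<^bsub>M\<^esub> \<or> c = \<one>\<^bsub>M\<^esub>)}"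

definition submonoid_generated :: "('a, 'm) monoid_scheme \<Rightarrow> 'a set \<Rightarrow> 'a set" where
  "submonoid_generated M X = \<Inter>{H. submonoid H M \<and> X \<subseteq> H}"

definition parabolic_submonoid :: "'a set \<Rightarrow> ('a, 'm) monoid_scheme \<Rightarrow> bool" where
  "parabolic_submonoid N M \<longleftrightarrow>
     submonoid N M \<and>
     (\<forall>a\<in>carrier M. \<forall>b\<in>carrier M. a \<otimes>\<^bsub>M\<^esub> b \<in> N \<longrightarrow> a \<in> N \<and> b \<in> N) \<and>
     (\<forall>a\<in>N. \<forall>b\<in>N. \<forall>m. is_left_join M a b m \<longrightarrow> m \<in> N) \<and>
     (\<forall>a\<in>N. \<forall>b\<in>N. \<forall>m. is_right_join M a b m \<longrightarrow> m \<in> N)"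

text \<open>Words over \<open>S\<close> are lists in \<open>lists S\<close>; a word represents the product of its letters.\<close>

definition word_val :: "('a, 'm) monoid_scheme \<Rightarrow> 'a list \<Rightarrow> 'a" where
  "word_val M w = foldr (\<otimes>\<^bsub>M\<^esub>) w \<one>\<^bsub>M\<^esub>"

text \<open>
  A selector is a total function that is constrained only on the pairs of distinct letters
  whose join exists; its other values are junk. The standing assumptions that \<open>S\<close> generates
  \<open>M\<close> and does not contain the unit are not part of the definitions; for \<open>S = atoms M\<close> they
  hold automatically (lemmas \<open>atoms_generate\<close> and \<open>one_notin_atoms\<close>).
\<close>

definition left_selector ::
    "('a, 'm) monoid_scheme \<Rightarrow> 'a set \<Rightarrow> ('a \<Rightarrow> 'a \<Rightarrow> 'a list) \<Rightarrow> bool" where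
  "left_selector M S f \<longleftrightarrow>
     (\<forall>x\<in>S. \<forall>y\<in>S. \<forall>m. x \<noteq> y \<and> is_left_join M x y m \<longrightarrow>
        f x y \<in> lists S \<and> word_val M (x # f x y) = m \<and> word_val M (y # f y x) = m)"

definition right_selector ::
    "('a, 'm) monoid_scheme \<Rightarrow> 'a set \<Rightarrow> ('a \<Rightarrow> 'a \<Rightarrow> 'a list) \<Rightarrow> bool" where
  "right_selector M S f \<longleftrightarrow>
     (\<forall>x\<in>S. \<forall>y\<in>S. \<forall>m. x \<noteq> y \<and> is_right_join M x y m \<longrightarrow>
        f x y \<in> lists S \<and> word_val M (f y x @ [x]) = m \<and> word_val M (f x y @ [y]) = m)"

lemma one_notin_atoms: "\<one>\<^bsub>M\<^esub> \<notin> atoms M"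
  by (simp add: atoms_def)

context preGarside
begin

lemma mult_eq_oneD:
  assumes "a \<in> carrier M" "b \<in> carrier M" "a \<otimes> b = \<one>"
  shows "a = \<one> \<and> b = \<one>"
proof -
  obtain \<nu> :: "'a \<Rightarrow> nat" where pos: "\<And>a. a \<in> carrier M \<Longrightarrow> a \<noteq> \<one> \<Longrightarrow> \<nu> a > 0"
    and add: "\<And>a b. a \<in> carrier M \<Longrightarrow> b \<in> carrier M \<Longrightarrow> \<nu> (a \<otimes> b) \<ge> \<nu> a + \<nu> b"
    using atomic by blast
  have "\<nu> \<one> = 0"
    using add[of \<one> \<one>] by simp
  then have "\<nu> a = 0" "\<nu> b = 0"
    using add[of a b] assms by simp_all
  then show ?thesis
    using pos assms by (metis less_irrefl)
qed

lemma left_join_unique: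
  assumes "is_left_join M a b m" "is_left_join M a b n"
  shows "m = n"
proof -
  have mn: "m \<in> carrier M" "n \<in> carrier M" "m divides n" "n divides m"
    using assms by (auto simp: is_left_join_def)
  obtain c d where c: "c \<in> carrier M" "n = m \<otimes> c" and d: "d \<in> carrier M" "m = n \<otimes> d"
    using mn by (auto simp: factor_def)
  have "m \<otimes> (c \<otimes> d) \<otimes> \<one> = m \<otimes> \<one> \<otimes> \<one>"
    using c(1) d(1) mn(1) c(2)[symmetric] d(2)[symmetric] by (simp flip: m_assoc)
  then have "c \<otimes> d = \<one>"
    using cancellative[of "c \<otimes> d" \<one> m \<one>] c(1) d(1) mn(1) by simp
  then have "c = \<one>"
    using mult_eq_oneD c(1) d(1) by blast
  then show ?thesis
    using c(2) mn(1) by simp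
qed

lemma right_join_unique:
  assumes "is_right_join M a b m" "is_right_join M a b n"
  shows "m = n"
proof -
  have mn: "m \<in> carrier M" "n \<in> carrier M" "right_divides M m n" "right_divides M n m"
    using assms by (auto simp: is_right_join_def)
  obtain c d where c: "c \<in> carrier M" "n = c \<otimes> m" and d: "d \<in> carrier M" "m = d \<otimes> n"
    using mn by (auto simp: right_divides_def)
  have "\<one> \<otimes> (d \<otimes> c) \<otimes> m = \<one> \<otimes> \<one> \<otimes> m"
    using c(1) d(1) mn(1) c(2)[symmetric] d(2)[symmetric] by (simp add: m_assoc)
  then have "d \<otimes> c = \<one>"
    using cancellative[of "d \<otimes> c" \<one> \<one> m] c(1) d(1) mn(1) by simp
  then have "c = \<one>"
    using mult_eq_oneD c(1) d(1) by blast
  then show ?thesis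
    using c(2) mn(1) by simp
qed

lemma atoms_generate: "submonoid_generated M (atoms M) = carrier M"
proof
  have "submonoid (carrier M) M"
    by unfold_locales auto
  moreover have "atoms M \<subseteq> carrier M"
    by (auto simp: atoms_def)
  ultimately show "submonoid_generated M (atoms M) \<subseteq> carrier M"
    unfolding submonoid_generated_def by blast
next
  obtain \<nu> :: "'a \<Rightarrow> nat" where pos: "\<And>a. a \<in> carrier M \<Longrightarrow> a \<noteq> \<one> \<Longrightarrow> \<nu> a > 0"
    and add: "\<And>a b. a \<in> carrier M \<Longrightarrow> b \<in> carrier M \<Longrightarrow> \<nu> (a \<otimes> b) \<ge> \<nu> a + \<nu> b"
    using atomic by blast
  have "a \<in> H" if H: "submonoid H M" "atoms M \<subseteq> H" and a: "a \<in> carrier M" for H a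
    using a
  proof (induction "\<nu> a" arbitrary: a rule: less_induct)
    case less
    show ?case
    proof (cases "a = \<one> \<or> a \<in> atoms M")
      case True
      then show ?thesis
        using H submonoid.one_closed by blast
    next
      case False
      then obtain b c where bc: "b \<in> carrier M" "c \<in> carrier M" "a = b \<otimes> c" "b \<noteq> \<one>" "c \<noteq> \<one>"
        using less.prems by (auto simp: atoms_def)
      have "\<nu> b < \<nu> a" "\<nu> c < \<nu> a"
        using add[of b c] pos[of b] pos[of c] bc by auto
      then show ?thesis
        using less.hyps bc submonoid.m_closed[OF H(1)] by blast
    qed
  qed
  then show "carrier M \<subseteq> submonoid_generated M (atoms M)"
    by (auto simp: submonoid_generated_def)
qed

end

end

theory Submission imports Defs begin

text \<open>
  The theorem splits into a statement about \<open>\<preceq>\<^sub>L\<close> and its mirror image. Closure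
  under factors does not mention a side, so it suffices to show, for the left side alone, that \<open>N\<close>
  is closed under factors and left joins iff the left halves of (a) and (b) hold
  (\<open>left_parabolic_iff_selector\<close>); the right side is the same result in the opposite
  monoid, where a right selector, with arguments swapped and words reversed, is a left selector.

  If \<open>N\<close> is closed under factors and left joins, then all letters of a word that
  represents an element of \<open>N\<close> are atoms in \<open>N\<close>, hence lie in \<open>X\<close>.
  Applied to the two words for \<open>x \<or>\<^sub>L y\<close>, this gives (a) and (b).

  Conversely, everything rests on one step (\<open>left_atom_quotient\<close>): if
  \<open>c \<in> N\<close> is divisible on the left by an atom \<open>y\<close>, write
  \<open>c = x \<otimes> c'\<close> with \<open>x \<in> X\<close>. For \<open>x \<noteq> y\<close> the join of
  \<open>x\<close> and \<open>y\<close> divides \<open>c\<close>, so the value of \<open>f\<^sub>L(x,y)\<close> divides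
  \<open>c'\<close>. By induction its letters lie in \<open>X\<close>, so (b) gives \<open>y \<in> X\<close>, and
  then (a) shows that the quotient of \<open>c\<close> by \<open>y\<close> is again in \<open>N\<close>. Peeling off
  atoms one at a time yields closure under factors. For joins it is enough to
  find, below any common multiple \<open>m\<close> of \<open>a, b \<in> N\<close>, a common multiple that lies
  in \<open>N\<close> (\<open>common_multiple_in_generated\<close>): if \<open>m\<close> is the join, it divides
  that multiple and is therefore itself a factor of an element of \<open>N\<close>.
\<close>

section \<open>Words, atoms and generated submonoids\<close>

context monoid
begin

lemma word_val_simps [simp]:
  "word_val G [] = \<one>" "word_val G (x # w) = x \<otimes> word_val G w"
  by (simp_all add: word_val_def)

lemma word_val_closed: "set w \<subseteq> carrier G \<Longrightarrow> word_val G w \<in> carrier G"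
  by (induction w) auto

lemma word_val_append:
  "set v \<subseteq> carrier G \<Longrightarrow> set w \<subseteq> carrier G \<Longrightarrow> word_val G (v @ w) = word_val G v \<otimes> word_val G w"
  by (induction v) (auto simp: m_assoc word_val_closed)

lemma letter_is_factor:
  assumes "set w \<subseteq> carrier G" "z \<in> set w"
  shows "\<exists>a\<in>carrier G. \<exists>d\<in>carrier G. word_val G w = a \<otimes> z \<otimes> d"
proof -
  obtain s t where w: "w = s @ z # t"
    using split_list[OF assms(2)] by blast
  then have "word_val G w = word_val G s \<otimes> z \<otimes> word_val G t"
    using assms(1) by (simp add: word_val_append m_assoc word_val_closed)
  then show ?thesis
    using w assms(1) word_val_closed[of s] word_val_closed[of t] by auto
qed

lemma submonoid_generated_submonoid:
  assumes "X \<subseteq> carrier G"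
  shows "submonoid (submonoid_generated G X) G"
proof -
  have "submonoid (carrier G) G"
    by unfold_locales auto
  then show ?thesis
    using assms unfolding submonoid_generated_def
    by (intro submonoid.intro)
      (blast dest: submonoid.subset submonoid.m_closed submonoid.one_closed)+
qed

lemma generators_subset: "X \<subseteq> submonoid_generated G X"
  by (auto simp: submonoid_generated_def)

lemma word_val_in_submonoid: "submonoid H G \<Longrightarrow> set w \<subseteq> H \<Longrightarrow> word_val G w \<in> H"
  by (induction w) (auto simp: submonoid.m_closed submonoid.one_closed)

lemma submonoid_generated_cases:
  assumes X: "X \<subseteq> carrier G" and c: "c \<in> submonoid_generated G X"
  obtains "c = \<one>" | x n where "x \<in> X" "n \<in> submonoid_generated G X" "c = x \<otimes> n"
proof -
  let ?N = "submonoid_generated G X"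
  let ?H = "insert \<one> {x \<otimes> n | x n. x \<in> X \<and> n \<in> ?N}"
  have N: "submonoid ?N G"
    by (rule submonoid_generated_submonoid[OF X])
  have N_carr: "?N \<subseteq> carrier G"
    by (rule submonoid.subset[OF N])
  have HN: "?H \<subseteq> ?N"
    using N generators_subset[of X] submonoid.m_closed[OF N] submonoid.one_closed[OF N] by auto
  have "submonoid ?H G"
  proof
    show H_carr: "?H \<subseteq> carrier G"
      using HN N_carr by blast
    show "\<one> \<in> ?H"
      by simp
    fix a b assume ab: "a \<in> ?H" "b \<in> ?H"
    show "a \<otimes> b \<in> ?H"
    proof (cases "a = \<one>")
      case True
      moreover have "b \<in> carrier G"
        using ab(2) H_carr by blast
      ultimately show ?thesis
        using ab(2) by (simp only: l_one)
    next
      case False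
      then obtain x n where xn: "x \<in> X" "n \<in> ?N" "a = x \<otimes> n"
        using ab(1) by blast
      have "b \<in> ?N"
        using ab(2) HN by blast
      then have "n \<otimes> b \<in> ?N" "a \<otimes> b = x \<otimes> (n \<otimes> b)"
        using xn X N_carr submonoid.m_closed[OF N] by (auto simp: m_assoc subset_iff)
      then show ?thesis
        using xn(1) by blast
    qed
  qed
  moreover have "X \<subseteq> ?H"
  proof
    fix x assume x: "x \<in> X"
    then have "x = x \<otimes> \<one>"
      using X by auto
    then show "x \<in> ?H"
      using x submonoid.one_closed[OF N] by blast
  qed
  ultimately have "c \<in> ?H"
    using c by (auto simp: submonoid_generated_def)
  then show ?thesis
    using that by blast
qed

lemma atoms_carrier: "atoms G \<subseteq> carrier G"
  by (auto simp: atoms_def)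

text \<open>An atom cannot be a product of two or more generators, none of which is \<open>\<one>\<close>.\<close>

lemma atom_in_generated:
  assumes X: "X \<subseteq> atoms G" and z: "z \<in> atoms G" "z \<in> submonoid_generated G X"
  shows "z \<in> X"
proof -
  have X_carr: "X \<subseteq> carrier G"
    using X atoms_carrier by blast
  show ?thesis
    using X_carr z(2)
  proof (cases rule: submonoid_generated_cases)
    case 1
    then show ?thesis
      using z(1) by (simp add: atoms_def)
  next
    case (2 x n)
    moreover have "n \<in> carrier G"
      using 2 submonoid.subset[OF submonoid_generated_submonoid[OF X_carr]] by blast
    ultimately have "n = \<one>"
      using X z(1) by (auto simp: atoms_def)
    then show ?thesis
      using 2 X_carr by auto
  qed
qed

end

section \<open>Induction on factors\<close>

context preGarside
begin

lemma left_cancel: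
  "\<lbrakk>a \<in> carrier M; b \<in> carrier M; c \<in> carrier M; c \<otimes> a = c \<otimes> b\<rbrakk> \<Longrightarrow> a = b"
  using cancellative[of a b c \<one>] by simp

text \<open>
  Removing a nontrivial left factor lowers the atomicity norm, and removing anything on the right
  does not raise it. The factor \<open>d\<close> is there because the induction has to reach the value
  of a selector word, which sits in the middle of an element rather than at its right end.
\<close>

lemma factor_induct [consumes 1, case_names factor]:
  assumes "c \<in> carrier M"
    and step: "\<And>c. \<lbrakk>c \<in> carrier M;
      \<And>a b d. \<lbrakk>a \<in> carrier M; b \<in> carrier M; d \<in> carrier M; a \<noteq> \<one>; c = a \<otimes> (b \<otimes> d)\<rbrakk> \<Longrightarrow> P b\<rbrakk>
      \<Longrightarrow> P c"
  shows "P c"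
proof -
  obtain \<nu> :: "'a \<Rightarrow> nat" where pos: "\<And>a. a \<in> carrier M \<Longrightarrow> a \<noteq> \<one> \<Longrightarrow> \<nu> a > 0"
    and add: "\<And>a b. a \<in> carrier M \<Longrightarrow> b \<in> carrier M \<Longrightarrow> \<nu> (a \<otimes> b) \<ge> \<nu> a + \<nu> b"
    using atomic by blast
  show ?thesis
    using assms(1)
  proof (induction "\<nu> c" arbitrary: c rule: less_induct)
    case less
    show ?case
    proof (rule step[OF less.prems])
      fix a b d assume *: "a \<in> carrier M" "b \<in> carrier M" "d \<in> carrier M" "a \<noteq> \<one>"
        "c = a \<otimes> (b \<otimes> d)"
      have "\<nu> b < \<nu> c"
        using add[of a "b \<otimes> d"] add[of b d] pos[of a] * by simp
      then show "P b"
        using less.hyps *(2) by blast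
    qed
  qed
qed

lemma split_off_left_atom:
  assumes "a \<in> carrier M" "a \<noteq> \<one>"
  obtains y a' where "y \<in> atoms M" "y \<in> carrier M" "y \<noteq> \<one>" "a' \<in> carrier M" "a = y \<otimes> a'"
proof -
  have "a \<in> submonoid_generated M (atoms M)"
    using assms(1) atoms_generate by simp
  with atoms_carrier show ?thesis
    using that assms(2) atoms_generate
    by (cases rule: submonoid_generated_cases) (auto simp: atoms_def)
qed

end

section \<open>The left half of the characterization\<close>

locale generated_by_atoms = preGarside +
  fixes X N :: "'a set" and f :: "'a \<Rightarrow> 'a \<Rightarrow> 'a list"
  assumes X_atoms: "X \<subseteq> atoms M"
    and N_def: "N = submonoid_generated M X"
    and selector: "left_selector M (atoms M) f"
begin

lemma X_carrier: "X \<subseteq> carrier M"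
  using X_atoms atoms_carrier by blast

lemma N_submonoid: "submonoid N M"
  unfolding N_def by (rule submonoid_generated_submonoid[OF X_carrier])

lemma N_carrier: "a \<in> N \<Longrightarrow> a \<in> carrier M"
  using submonoid.subset[OF N_submonoid] by blast

lemmas N_mult = submonoid.m_closed[OF N_submonoid]
  and N_one = submonoid.one_closed[OF N_submonoid]

lemma X_subset_N: "X \<subseteq> N"
  unfolding N_def by (rule generators_subset)

lemma atom_in_N: "z \<in> atoms M \<Longrightarrow> z \<in> N \<Longrightarrow> z \<in> X"
  using atom_in_generated[OF X_atoms] by (simp add: N_def)

lemma N_cases:
  assumes "a \<in> N"
  obtains "a = \<one>" | x a' where "x \<in> X" "a' \<in> N" "a = x \<otimes> a'"
  using submonoid_generated_cases[OF X_carrier, of a] assms unfolding N_def by blast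

lemma word_in_N: "w \<in> lists X \<Longrightarrow> word_val M w \<in> N"
  using X_subset_N by (intro word_val_in_submonoid[OF N_submonoid]) auto

lemma selector_join:
  assumes "x \<in> atoms M" "y \<in> atoms M" "x \<noteq> y" "is_left_join M x y m"
  shows "f x y \<in> lists (atoms M)" "m = x \<otimes> word_val M (f x y)"
    and "f y x \<in> lists (atoms M)" "m = y \<otimes> word_val M (f y x)"
proof -
  have "is_left_join M y x m"
    using assms(4) by (auto simp: is_left_join_def)
  then show "f x y \<in> lists (atoms M)" "m = x \<otimes> word_val M (f x y)"
    and "f y x \<in> lists (atoms M)" "m = y \<otimes> word_val M (f y x)"
    using assms selector by (auto simp: left_selector_def)
qed

lemma selector_word_closed:
  assumes "x \<in> atoms M" "y \<in> atoms M" "x \<noteq> y" "is_left_join M x y m"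
  shows "word_val M (f x y) \<in> carrier M" "word_val M (f y x) \<in> carrier M"
  using selector_join[OF assms] atoms_carrier by (auto intro!: word_val_closed)

text \<open>The letters of a word are factors of its value, and the atoms in \<open>N\<close> are the elements of
  \<open>X\<close>.\<close>

lemma word_of_factor_closed:
  assumes closed: "\<And>a b d. \<lbrakk>a \<in> carrier M; b \<in> carrier M; d \<in> carrier M;
      word_val M w = a \<otimes> b \<otimes> d\<rbrakk> \<Longrightarrow> b \<in> N"
    and w: "w \<in> lists (atoms M)"
  shows "w \<in> lists X"
proof -
  have "z \<in> X" if "z \<in> set w" for z
  proof -
    have "z \<in> atoms M" "z \<in> carrier M" "set w \<subseteq> carrier M"
      using w that atoms_carrier by auto
    then show ?thesis
      using letter_is_factor[of w z] that closed atom_in_N by blast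
  qed
  then show ?thesis
    by auto
qed

subsection \<open>From closure properties to selector conditions\<close>

lemma selector_conditions_of_closed:
  assumes factor: "\<forall>a\<in>carrier M. \<forall>b\<in>carrier M. a \<otimes> b \<in> N \<longrightarrow> a \<in> N \<and> b \<in> N"
    and join: "\<forall>a\<in>N. \<forall>b\<in>N. \<forall>m. is_left_join M a b m \<longrightarrow> m \<in> N"
  shows "\<forall>x\<in>X. \<forall>y\<in>X. x \<noteq> y \<and> left_join_exists M x y \<longrightarrow> f x y \<in> lists X \<and> f y x \<in> lists X"
    and "\<forall>x\<in>X. \<forall>y\<in>atoms M - X. left_join_exists M x y \<longrightarrow> f x y \<notin> lists X"
proof -
  have word: "w \<in> lists X" if "word_val M w \<in> N" "w \<in> lists (atoms M)" for w
    using _ that(2)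
  proof (rule word_of_factor_closed)
    fix a b d assume "a \<in> carrier M" "b \<in> carrier M" "d \<in> carrier M" "word_val M w = a \<otimes> b \<otimes> d"
    then show "b \<in> N"
      using that(1) factor by (metis m_closed)
  qed
  show "\<forall>x\<in>X. \<forall>y\<in>X. x \<noteq> y \<and> left_join_exists M x y \<longrightarrow> f x y \<in> lists X \<and> f y x \<in> lists X"
  proof (intro ballI impI)
    fix x y assume xy: "x \<in> X" "y \<in> X" "x \<noteq> y \<and> left_join_exists M x y"
    then obtain m where m: "is_left_join M x y m"
      by (auto simp: left_join_exists_def)
    have at: "x \<in> atoms M" "y \<in> atoms M" "x \<noteq> y" "x \<in> carrier M" "y \<in> carrier M"
      using xy X_atoms atoms_carrier by auto
    have "m \<in> N"
      using join m xy X_subset_N by blast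
    then have "word_val M (f x y) \<in> N" "word_val M (f y x) \<in> N"
      using factor selector_join[OF at(1-3) m] selector_word_closed[OF at(1-3) m] at by metis+
    then show "f x y \<in> lists X \<and> f y x \<in> lists X"
      using word selector_join[OF at(1-3) m] by blast
  qed
  show "\<forall>x\<in>X. \<forall>y\<in>atoms M - X. left_join_exists M x y \<longrightarrow> f x y \<notin> lists X"
  proof (intro ballI impI notI)
    fix x y assume xy: "x \<in> X" "y \<in> atoms M - X" "left_join_exists M x y" "f x y \<in> lists X"
    then obtain m where m: "is_left_join M x y m"
      by (auto simp: left_join_exists_def)
    have at: "x \<in> atoms M" "y \<in> atoms M" "x \<noteq> y" "x \<in> carrier M" "y \<in> carrier M"
      using xy X_atoms atoms_carrier by auto
    have "m \<in> N"
      using selector_join(2)[OF at(1-3) m] word_in_N[OF xy(4)] xy(1) X_subset_N N_mult by auto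
    then have "y \<in> N"
      using factor selector_join(4)[OF at(1-3) m] selector_word_closed[OF at(1-3) m] at by metis
    then show False
      using atom_in_N xy(2) by blast
  qed
qed

end

subsection \<open>From selector conditions to closure properties\<close>

locale selector_conditions = generated_by_atoms +
  assumes cond_a: "\<lbrakk>x \<in> X; y \<in> X; x \<noteq> y; left_join_exists M x y\<rbrakk> \<Longrightarrow> f x y \<in> lists X \<and> f y x \<in> lists X"
    and cond_b: "\<lbrakk>x \<in> X; y \<in> atoms M; y \<notin> X; left_join_exists M x y\<rbrakk> \<Longrightarrow> f x y \<notin> lists X"
begin

text \<open>
  The heart of closure under factors: an atom on the left of \<open>c\<close> can be split off without
  leaving \<open>N\<close>. The assumption \<open>IH\<close> is the induction hypothesis of that closure:
  elements of \<open>N\<close> that arise from \<open>c\<close> by removing a nontrivial left factor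
  (and possibly a right one, \<open>g\<close>) have all their factors in \<open>N\<close>.
\<close>

lemma left_atom_quotient:
  assumes IH: "\<And>e c' g a b d. \<lbrakk>e \<in> carrier M; e \<noteq> \<one>; c' \<in> N; g \<in> carrier M; c = e \<otimes> (c' \<otimes> g);
        a \<in> carrier M; b \<in> carrier M; d \<in> carrier M; c' = a \<otimes> b \<otimes> d\<rbrakk> \<Longrightarrow> b \<in> N"
    and c: "c \<in> N" and y: "y \<in> atoms M" and q: "q \<in> carrier M" "c = y \<otimes> q"
  shows "y \<in> X \<and> q \<in> N"
proof -
  have y_carr: "y \<in> carrier M" and y1: "y \<noteq> \<one>"
    using y by (auto simp: atoms_def)
  have "c \<noteq> \<one>"
    using mult_eq_oneD[OF y_carr q(1)] q(2) y1 by auto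
  then obtain x c' where x: "x \<in> X" and c': "c' \<in> N" "c = x \<otimes> c'"
    using N_cases[OF c] by blast
  have x_at: "x \<in> atoms M" and x_carr: "x \<in> carrier M" and x1: "x \<noteq> \<one>"
    using x X_atoms by (auto simp: atoms_def)
  have c'_carr: "c' \<in> carrier M" and c_carr: "c \<in> carrier M"
    using c' c N_carrier by auto
  show ?thesis
  proof (cases "x = y")
    case True
    then have "q = c'"
      using left_cancel[OF q(1) c'_carr y_carr] q(2) c'(2) by simp
    then show ?thesis
      using True x c'(1) by simp
  next
    case False
    have x_dvd: "x divides c" and y_dvd: "y divides c"
      using dividesI[OF c'_carr c'(2)] dividesI[OF q] .
    then have ex: "left_join_exists M x y"
      using left_join_if_bounded[OF x_carr y_carr] c_carr by blast
    then obtain m where m: "is_left_join M x y m"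
      by (auto simp: left_join_exists_def)
    define v w where "v = word_val M (f x y)" and "w = word_val M (f y x)"
    have v: "v \<in> carrier M" "m = x \<otimes> v" and w: "w \<in> carrier M" "m = y \<otimes> w"
      using selector_join[OF x_at y False m] selector_word_closed[OF x_at y False m]
      by (auto simp: v_def w_def)
    have "m divides c"
      using m c_carr x_dvd y_dvd by (auto simp: is_left_join_def)
    then obtain u where u: "u \<in> carrier M" "c = m \<otimes> u"
      by (auto simp: factor_def)
    have c'_vu: "c' = v \<otimes> u"
      using u v c' c'_carr x_carr by (intro left_cancel[of c' "v \<otimes> u" x]) (simp_all add: m_assoc)
    have q_wu: "q = w \<otimes> u"
      using u w q y_carr by (intro left_cancel[of q "w \<otimes> u" y]) (simp_all add: m_assoc)
    have factors_of_c': "b \<in> N"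
      if "a \<in> carrier M" "b \<in> carrier M" "d \<in> carrier M" "c' = a \<otimes> b \<otimes> d" for a b d
      using IH[of x c' \<one> a b d] that x_carr x1 c' c'_carr by simp
    have v_N: "v \<in> N" and u_N: "u \<in> N"
      using factors_of_c'[of \<one> v u] factors_of_c'[of v u \<one>] c'_vu u v by simp_all
    \<comment> \<open>The value of \<open>f x y\<close> is the middle factor in \<open>c = x \<otimes> (v \<otimes> u)\<close>.\<close>
    have "f x y \<in> lists X"
    proof (rule word_of_factor_closed)
      fix a b d assume "a \<in> carrier M" "b \<in> carrier M" "d \<in> carrier M"
        "word_val M (f x y) = a \<otimes> b \<otimes> d"
      then show "b \<in> N"
        using IH[of x v u a b d] x_carr x1 v_N u c'(2) c'_vu by (simp add: v_def)
    qed (rule selector_join(1)[OF x_at y False m])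
    then have y_X: "y \<in> X"
      using cond_b[OF x y _ ex] by blast
    then have "w \<in> N"
      using cond_a[OF x _ False ex] word_in_N by (simp add: w_def)
    then show ?thesis
      using y_X q_wu u_N N_mult by simp
  qed
qed

text \<open>
  Factors in the middle are treated at once, since both the left atoms of \<open>a\<close> and those of
  \<open>b\<close> are peeled off, and \<open>d\<close> stays behind.
\<close>

lemma factor_closed:
  assumes "c \<in> carrier M"
  shows "\<lbrakk>c \<in> N; a \<in> carrier M; b \<in> carrier M; d \<in> carrier M; c = a \<otimes> b \<otimes> d\<rbrakk> \<Longrightarrow> b \<in> N"
  using assms
proof (induction c arbitrary: a b d rule: factor_induct)
  case (factor c)
  have peel: "y \<in> X \<and> q \<in> N" if "y \<in> atoms M" "q \<in> carrier M" "c = y \<otimes> q" for y q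
    using _ factor.prems(1) that
  proof (rule left_atom_quotient)
    fix e c' g a b d assume "e \<in> carrier M" "e \<noteq> \<one>" "c' \<in> N" "g \<in> carrier M" "c = e \<otimes> (c' \<otimes> g)"
      "a \<in> carrier M" "b \<in> carrier M" "d \<in> carrier M" "c' = a \<otimes> b \<otimes> d"
    then show "b \<in> N"
      using factor.IH[of e c' g a b d] N_carrier by blast
  qed
  show ?case
  proof (cases "a = \<one>")
    case False
    then obtain y a' where y: "y \<in> atoms M" "y \<in> carrier M" "y \<noteq> \<one>"
      and a': "a' \<in> carrier M" "a = y \<otimes> a'"
      using split_off_left_atom[OF factor.prems(2)] by blast
    have c_eq: "c = y \<otimes> (a' \<otimes> b \<otimes> d)"
      using factor.prems(3-5) a' y(2) by (simp add: m_assoc)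
    then have q: "a' \<otimes> b \<otimes> d \<in> N"
      using peel[OF y(1) _ c_eq] a'(1) factor.prems(3,4) by simp
    have "c = y \<otimes> (a' \<otimes> b \<otimes> d \<otimes> \<one>)"
      using c_eq N_carrier[OF q] by simp
    then show ?thesis
      using factor.IH[OF y(2) N_carrier[OF q] one_closed y(3) _ q a'(1) factor.prems(3,4)] by blast
  next
    case a1: True
    show ?thesis
    proof (cases "b = \<one>")
      case True
      then show ?thesis
        using N_one by simp
    next
      case False
      then obtain y b' where y: "y \<in> atoms M" "y \<in> carrier M" "y \<noteq> \<one>"
        and b': "b' \<in> carrier M" "b = y \<otimes> b'"
        using split_off_left_atom[OF factor.prems(3)] by blast
      have c_eq: "c = y \<otimes> (b' \<otimes> d)"
        using factor.prems(4,5) b' y(2) a1 by (simp add: m_assoc)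
      then have yX: "y \<in> X" and q: "b' \<otimes> d \<in> N"
        using peel[OF y(1) _ c_eq] b'(1) factor.prems(4) by simp_all
      have "c = y \<otimes> (b' \<otimes> d \<otimes> \<one>)" "b' \<otimes> d = \<one> \<otimes> b' \<otimes> d"
        using c_eq N_carrier[OF q] b'(1) by simp_all
      then have "b' \<in> N"
        using factor.IH[OF y(2) N_carrier[OF q] one_closed y(3) _ q one_closed b'(1) factor.prems(4)]
        by blast
      then show ?thesis
        using b'(2) yX X_subset_N N_mult by auto
    qed
  qed
qed

lemma left_right_factor_closed:
  assumes "a \<in> carrier M" "b \<in> carrier M" "a \<otimes> b \<in> N"
  shows "a \<in> N" "b \<in> N"
proof -
  have ab: "a \<otimes> b \<in> carrier M" "a \<otimes> b = \<one> \<otimes> a \<otimes> b" "a \<otimes> b = a \<otimes> b \<otimes> \<one>"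
    using assms(1,2) by simp_all
  show "a \<in> N"
    by (rule factor_closed[OF ab(1) assms(3) one_closed assms(1,2) ab(2)])
  show "b \<in> N"
    by (rule factor_closed[OF ab(1) assms(3) assms(1,2) one_closed ab(3)])
qed

text \<open>
  The proof completes the square of \<open>a = x \<otimes> a'\<close> and
  \<open>b = y \<otimes> b'\<close> inside \<open>m\<close>. With \<open>j = x \<otimes> v = y \<otimes> w\<close> the join of
  \<open>x\<close> and \<open>y\<close>, common multiples of \<open>a', v\<close> and of \<open>b', w\<close> give
  multiples \<open>j \<otimes> p'\<close> of \<open>a\<close> and \<open>j \<otimes> r'\<close> of \<open>b\<close>, and a common multiple of
  \<open>p'\<close> and \<open>r'\<close> closes the square. All three come from the induction
  hypothesis, since they live in right factors of \<open>m\<close>.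
\<close>

lemma common_multiple_in_generated:
  assumes "m \<in> carrier M"
  shows "\<lbrakk>a \<in> N; b \<in> N; a divides m; b divides m\<rbrakk> \<Longrightarrow>
    \<exists>n\<in>N. a divides n \<and> b divides n \<and> n divides m"
  using assms
proof (induction m arbitrary: a b rule: factor_induct)
  case (factor m)
  have IH: "\<exists>n\<in>N. a divides n \<and> b divides n \<and> n divides m'"
    if "e \<in> carrier M" "e \<noteq> \<one>" "m' \<in> carrier M" "m = e \<otimes> m'"
      "a \<in> N" "b \<in> N" "a divides m'" "b divides m'" for e m' a b
    using factor.IH[of e m' \<one> a b] that by simp
  obtain ka kb where ka: "ka \<in> carrier M" "m = a \<otimes> ka" and kb: "kb \<in> carrier M" "m = b \<otimes> kb"
    using factor.prems by (auto simp: factor_def)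
  have ab_carr: "a \<in> carrier M" "b \<in> carrier M"
    using factor.prems N_carrier by auto
  show ?case
  proof (cases "a = \<one> \<or> b = \<one>")
    case True
    have "\<one> divides a" "\<one> divides b"
      using ab_carr by (auto intro: dividesI)
    then show ?thesis
      using True factor.prems ab_carr divides_refl by blast
  next
    case False
    obtain x a' where x: "x \<in> X" and a': "a' \<in> N" "a = x \<otimes> a'"
      using N_cases[OF factor.prems(1)] False by blast
    obtain y b' where y: "y \<in> X" and b': "b' \<in> N" "b = y \<otimes> b'"
      using N_cases[OF factor.prems(2)] False by blast
    have at: "x \<in> atoms M" "x \<in> carrier M" "x \<noteq> \<one>" "y \<in> atoms M" "y \<in> carrier M" "y \<noteq> \<one>"
      using x y X_atoms by (auto simp: atoms_def)
    have a'_carr: "a' \<in> carrier M" and b'_carr: "b' \<in> carrier M"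
      using a' b' N_carrier by auto
    define mx my where "mx = a' \<otimes> ka" and "my = b' \<otimes> kb"
    have mx: "mx \<in> carrier M" "m = x \<otimes> mx" "a' divides mx"
      and my: "my \<in> carrier M" "m = y \<otimes> my" "b' divides my"
      using ka kb a'(2) b'(2) a'_carr b'_carr at
      by (simp_all add: mx_def my_def m_assoc dividesI)
    show ?thesis
    proof (cases "x = y")
      case True
      then have "my = mx"
        using mx my at left_cancel[of my mx x] by simp
      then obtain n where n: "n \<in> N" "a' divides n" "b' divides n" "n divides mx"
        using IH[of x mx a' b'] at mx my a'(1) b'(1) by auto
      have "x \<otimes> n \<in> N"
        using n(1) x X_subset_N N_mult by auto
      then show ?thesis
        using n True a' b' a'_carr b'_carr mx at N_carrier[OF n(1)]
        by (auto intro!: bexI[of _ "x \<otimes> n"] divides_mult_lI)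
    next
      case False
      have x_dvd: "x divides m" and y_dvd: "y divides m"
        using dividesI[OF mx(1,2)] dividesI[OF my(1,2)] .
      then have ex: "left_join_exists M x y"
        using left_join_if_bounded[OF at(2,5)] factor.hyps by blast
      then obtain j where j: "is_left_join M x y j"
        by (auto simp: left_join_exists_def)
      define v w where "v = word_val M (f x y)" and "w = word_val M (f y x)"
      have vw: "j = x \<otimes> v" "j = y \<otimes> w"
        using selector_join[OF at(1,4) False j] by (auto simp: v_def w_def)
      have vw_N: "v \<in> N" "w \<in> N"
        using cond_a[OF x y False ex] word_in_N by (auto simp: v_def w_def)
      then have vw_carr: "v \<in> carrier M" "w \<in> carrier M"
        using N_carrier by auto
      have j_N: "j \<in> N" and j_carr: "j \<in> carrier M"
        using vw(1) vw_N x X_subset_N N_mult N_carrier by auto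
      have j1: "j \<noteq> \<one>"
        using mult_eq_oneD[OF at(2) vw_carr(1)] vw(1) at(3) by auto
      obtain k where k: "k \<in> carrier M" "m = j \<otimes> k"
        using j factor.hyps x_dvd y_dvd by (auto simp: is_left_join_def factor_def)
      have mx_eq: "mx = v \<otimes> k"
        using k mx vw vw_carr at by (intro left_cancel[of mx "v \<otimes> k" x]) (simp_all flip: m_assoc)
      have my_eq: "my = w \<otimes> k"
        using k my vw vw_carr at by (intro left_cancel[of my "w \<otimes> k" y]) (simp_all flip: m_assoc)
      obtain p where p: "p \<in> N" "a' divides p" "v divides p" "p divides mx"
        using IH[of x mx a' v] at mx a'(1) vw_N mx_eq k by auto
      obtain r where r: "r \<in> N" "b' divides r" "w divides r" "r divides my"
        using IH[of y my b' w] at my b'(1) vw_N my_eq k by auto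
      obtain p' where p': "p' \<in> carrier M" "p = v \<otimes> p'"
        using p(3) by (auto simp: factor_def)
      obtain r' where r': "r' \<in> carrier M" "r = w \<otimes> r'"
        using r(3) by (auto simp: factor_def)
      have pr_N: "p' \<in> N" "r' \<in> N"
        using left_right_factor_closed[of v p'] left_right_factor_closed[of w r'] p(1) r(1) p' r' vw_carr
        by auto
      have "p' divides k"
      proof -
        obtain t where t: "t \<in> carrier M" "mx = p \<otimes> t"
          using p(4) by (auto simp: factor_def)
        then have "k = p' \<otimes> t"
          using p' mx_eq vw_carr k by (intro left_cancel[of k "p' \<otimes> t" v]) (simp_all add: m_assoc)
        then show ?thesis
          using t(1) by (auto simp: factor_def)
      qed
      moreover have "r' divides k"
      proof -
        obtain t where t: "t \<in> carrier M" "my = r \<otimes> t"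
          using r(4) by (auto simp: factor_def)
        then have "k = r' \<otimes> t"
          using r' my_eq vw_carr k by (intro left_cancel[of k "r' \<otimes> t" w]) (simp_all add: m_assoc)
        then show ?thesis
          using t(1) by (auto simp: factor_def)
      qed
      ultimately obtain s where s: "s \<in> N" "p' divides s" "r' divides s" "s divides k"
        using IH[of j k p' r'] j_carr j1 k pr_N by auto
      have s_carr: "s \<in> carrier M"
        using s(1) N_carrier by blast
      have "a divides j \<otimes> p'"
      proof -
        have "x \<otimes> a' divides x \<otimes> p"
          using p at a'_carr N_carrier[OF p(1)] by (intro divides_mult_lI) auto
        then show ?thesis
          using a'(2) p' vw(1) vw_carr at by (simp add: m_assoc)
      qed
      moreover have "b divides j \<otimes> r'"
      proof -
        have "y \<otimes> b' divides y \<otimes> r"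
          using r at b'_carr N_carrier[OF r(1)] by (intro divides_mult_lI) auto
        then show ?thesis
          using b'(2) r' vw(2) vw_carr at by (simp add: m_assoc)
      qed
      moreover have "j \<otimes> p' divides j \<otimes> s" "j \<otimes> r' divides j \<otimes> s" "j \<otimes> s divides j \<otimes> k"
        using s p' r' j_carr s_carr k by (auto intro!: divides_mult_lI)
      ultimately show ?thesis
        using N_mult[OF j_N s(1)] k(2) ab_carr j_carr s_carr p'(1) r'(1)
        by (auto intro!: bexI[of _ "j \<otimes> s"] intro: divides_trans)
    qed
  qed
qed

lemma left_join_closed:
  assumes "a \<in> N" "b \<in> N" "is_left_join M a b m"
  shows "m \<in> N"
proof -
  have m: "m \<in> carrier M" "a divides m" "b divides m"
    using assms(3) by (auto simp: is_left_join_def)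
  then obtain n where n: "n \<in> N" "a divides n" "b divides n"
    using common_multiple_in_generated assms by blast
  then have "m divides n"
    using assms(3) N_carrier by (auto simp: is_left_join_def)
  then show ?thesis
    using n(1) m(1) left_right_factor_closed(1) by (auto simp: factor_def)
qed

end

theorem (in generated_by_atoms) left_parabolic_iff_selector:
  "(\<forall>a\<in>carrier M. \<forall>b\<in>carrier M. a \<otimes> b \<in> N \<longrightarrow> a \<in> N \<and> b \<in> N) \<and>
   (\<forall>a\<in>N. \<forall>b\<in>N. \<forall>m. is_left_join M a b m \<longrightarrow> m \<in> N)
   \<longleftrightarrow>
   (\<forall>x\<in>X. \<forall>y\<in>X. x \<noteq> y \<and> left_join_exists M x y \<longrightarrow> f x y \<in> lists X \<and> f y x \<in> lists X) \<and>
   (\<forall>x\<in>X. \<forall>y\<in>atoms M - X. left_join_exists M x y \<longrightarrow> f x y \<notin> lists X)"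
  (is "?closed \<longleftrightarrow> ?conds")
proof
  assume closed: ?closed
  show ?conds
    by (intro conjI selector_conditions_of_closed closed[THEN conjunct1] closed[THEN conjunct2])
next
  assume conds: ?conds
  interpret selector_conditions M X N f
  proof
    show "f x y \<in> lists X \<and> f y x \<in> lists X"
      if "x \<in> X" "y \<in> X" "x \<noteq> y" "left_join_exists M x y" for x y
      using conds[THEN conjunct1] that by blast
    show "f x y \<notin> lists X"
      if "x \<in> X" "y \<in> atoms M" "y \<notin> X" "left_join_exists M x y" for x y
      using conds[THEN conjunct2] that by blast
  qed
  show ?closed
    by (intro conjI ballI allI impI) (erule (2) left_right_factor_closed left_join_closed)+
qed

section \<open>The opposite monoid\<close>

definition opposite :: "('a, 'm) monoid_scheme \<Rightarrow> ('a, 'm) monoid_scheme" where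
  "opposite M = M\<lparr>mult := \<lambda>a b. b \<otimes>\<^bsub>M\<^esub> a\<rparr>"

lemma opposite_simps [simp]:
  "carrier (opposite M) = carrier M"
  "\<one>\<^bsub>opposite M\<^esub> = \<one>\<^bsub>M\<^esub>"
  "a \<otimes>\<^bsub>opposite M\<^esub> b = b \<otimes>\<^bsub>M\<^esub> a"
  by (simp_all add: opposite_def)

lemma opposite_divides:
  "a divides\<^bsub>opposite M\<^esub> b \<longleftrightarrow> right_divides M a b"
  "right_divides (opposite M) a b \<longleftrightarrow> a divides\<^bsub>M\<^esub> b"
  by (auto simp: factor_def right_divides_def)

lemma opposite_join:
  "is_left_join (opposite M) = is_right_join M"
  "is_right_join (opposite M) = is_left_join M"
  "left_join_exists (opposite M) = right_join_exists M"
  "right_join_exists (opposite M) = left_join_exists M"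
  by (auto simp: fun_eq_iff is_left_join_def is_right_join_def left_join_exists_def
      right_join_exists_def opposite_divides)

lemma opposite_atoms: "atoms (opposite M) = atoms M"
  by (auto simp: atoms_def)

lemma opposite_submonoid_generated:
  "submonoid_generated (opposite M) X = submonoid_generated M X"
proof -
  have "submonoid H (opposite M) \<longleftrightarrow> submonoid H M" for H
    by (auto simp: submonoid_def)
  then show ?thesis
    by (simp add: submonoid_generated_def)
qed

lemma (in preGarside) opposite_preGarside: "preGarside (opposite M)"
proof (intro preGarside.intro preGarside_axioms.intro, unfold opposite_simps opposite_divides opposite_join)
  show "monoid (opposite M)"
    by (rule monoidI) (simp_all add: m_assoc)
  show "a = b"
    if "a \<in> carrier M" "b \<in> carrier M" "c \<in> carrier M" "d \<in> carrier M"
      "d \<otimes> (a \<otimes> c) = d \<otimes> (b \<otimes> c)" for a b c d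
    using cancellative[of a b d c] that by (simp add: m_assoc)
  show "\<exists>\<nu> :: 'a \<Rightarrow> nat. (\<forall>a\<in>carrier M. a \<noteq> \<one> \<longrightarrow> \<nu> a > 0) \<and>
      (\<forall>a\<in>carrier M. \<forall>b\<in>carrier M. \<nu> (b \<otimes> a) \<ge> \<nu> a + \<nu> b)"
    using atomic by (metis add.commute)
qed (fact left_join_if_bounded right_join_if_bounded)+

lemma (in monoid) opposite_word_val:
  "set w \<subseteq> carrier G \<Longrightarrow> word_val (opposite G) w = word_val G (rev w)"
proof (induction w)
  case Nil
  then show ?case by (simp add: word_val_def)
next
  case (Cons x w)
  have "word_val (opposite G) (x # w) = word_val (opposite G) w \<otimes> x"
    by (simp add: word_val_def)
  then show ?case
    using Cons by (simp add: word_val_append)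
qed

text \<open>
  Swapping the arguments is forced by the convention for right selectors, in which
  \<open>f\<^sub>R(y,x)\<close>, not \<open>f\<^sub>R(x,y)\<close>, is the complement of \<open>x\<close>.
\<close>

lemma (in monoid) opposite_selector:
  assumes "right_selector G (atoms G) f"
  shows "left_selector (opposite G) (atoms (opposite G)) (\<lambda>x y. rev (f y x))"
  unfolding left_selector_def opposite_atoms opposite_join
proof (intro ballI allI impI)
  fix x y m assume xy: "x \<in> atoms G" "y \<in> atoms G" "x \<noteq> y \<and> is_right_join G x y m"
  then have "is_right_join G y x m"
    by (auto simp: is_right_join_def)
  then have f: "f x y \<in> lists (atoms G)" "word_val G (f y x @ [x]) = m"
    "f y x \<in> lists (atoms G)" "word_val G (f x y @ [y]) = m"
    using assms xy unfolding right_selector_def by metis+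
  then have "set (x # rev (f y x)) \<subseteq> carrier G" "set (y # rev (f x y)) \<subseteq> carrier G"
    using xy atoms_carrier by auto
  then show "rev (f y x) \<in> lists (atoms G) \<and>
      word_val (opposite G) (x # rev (f y x)) = m \<and> word_val (opposite G) (y # rev (f x y)) = m"
    using f by (simp only: opposite_word_val) auto
qed

section \<open>The characterization of parabolic submonoids\<close>

theorem theorem2p8:
  fixes M :: "('a, 'm) monoid_scheme"
    and fL fR :: "'a \<Rightarrow> 'a \<Rightarrow> 'a list"
    and X N :: "'a set"
  assumes "preGarside M"
    and "left_selector M (atoms M) fL"
    and "right_selector M (atoms M) fR"
    and "X \<subseteq> atoms M"
    and "N = submonoid_generated M X"
  shows "parabolic_submonoid N M \<longleftrightarrow>
    ((\<forall>x\<in>X. \<forall>y\<in>X. x \<noteq> y \<and> left_join_exists M x y \<longrightarrow>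
        fL x y \<in> lists X \<and> fL y x \<in> lists X) \<and>
     (\<forall>x\<in>X. \<forall>y\<in>X. x \<noteq> y \<and> right_join_exists M x y \<longrightarrow>
        fR x y \<in> lists X \<and> fR y x \<in> lists X)) \<and>
    ((\<forall>x\<in>X. \<forall>y\<in>atoms M - X. left_join_exists M x y \<longrightarrow> fL x y \<notin> lists X) \<and>
     (\<forall>x\<in>X. \<forall>y\<in>atoms M - X. right_join_exists M x y \<longrightarrow> fR y x \<notin> lists X))"
proof -
  interpret left: generated_by_atoms M X N fL
    using assms by (simp add: generated_by_atoms_def generated_by_atoms_axioms_def)
  have right: "generated_by_atoms (opposite M) X N (\<lambda>x y. rev (fR y x))"
    using assms left.opposite_preGarside left.opposite_selector
    by (simp add: generated_by_atoms_def generated_by_atoms_axioms_def opposite_atoms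
        opposite_submonoid_generated)
  have rev_lists: "rev w \<in> lists X \<longleftrightarrow> w \<in> lists X" for w
    by auto
  have factors_swap: "(\<forall>a\<in>carrier M. \<forall>b\<in>carrier M. b \<otimes>\<^bsub>M\<^esub> a \<in> N \<longrightarrow> a \<in> N \<and> b \<in> N) \<longleftrightarrow>
      (\<forall>a\<in>carrier M. \<forall>b\<in>carrier M. a \<otimes>\<^bsub>M\<^esub> b \<in> N \<longrightarrow> a \<in> N \<and> b \<in> N)"
    by blast
  have words_swap: "fR y x \<in> lists X \<and> fR x y \<in> lists X \<longleftrightarrow> fR x y \<in> lists X \<and> fR y x \<in> lists X" for x y
    by (rule conj_commute)
  have right_iff:
    "(\<forall>a\<in>carrier M. \<forall>b\<in>carrier M. a \<otimes>\<^bsub>M\<^esub> b \<in> N \<longrightarrow> a \<in> N \<and> b \<in> N) \<and>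
     (\<forall>a\<in>N. \<forall>b\<in>N. \<forall>m. is_right_join M a b m \<longrightarrow> m \<in> N)
     \<longleftrightarrow>
     (\<forall>x\<in>X. \<forall>y\<in>X. x \<noteq> y \<and> right_join_exists M x y \<longrightarrow>
        fR x y \<in> lists X \<and> fR y x \<in> lists X) \<and>
     (\<forall>x\<in>X. \<forall>y\<in>atoms M - X. right_join_exists M x y \<longrightarrow> fR y x \<notin> lists X)"
    using generated_by_atoms.left_parabolic_iff_selector[OF right]
    unfolding opposite_simps opposite_join opposite_atoms rev_lists factors_swap
    by (subst words_swap)
  show ?thesis
    using left.N_submonoid left.left_parabolic_iff_selector right_iff
    unfolding parabolic_submonoid_def by argo
qed

end
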